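(* Let $f\in S(\mathbb{R})$ and let $B=\frac{d}{dt}+\frac{2\pi i a}{b}t$. Then for all $\omega\in\mathbb{R}$: (i) $\mathcal{F}_A(Bf)(\omega)=2\pi i\,\frac{\omega-p}{b}\,\mathcal{F}_A(f)(\omega)$; (ii) $B(\mathcal{F}_Af)(\omega)=\frac{2\pi i}{b}(a\omega+d\omega+\Omega)\,\mathcal{F}_A(f)(\omega)-\frac{2\pi i}{b}\,\mathcal{F}_A(tf(t))(\omega)$, where $\Omega=bq-dp$.
   Context: $A=\{a,b,c,d,p,q\}$ are real parameters with $ad-bc=1$ and $b\neq0$. $S(\mathbb{R})$ is the Schwartz space. The special affine Fourier transform is $\mathcal{F}_Af(\omega)=\frac{1}{\sqrt{|b|}}\int_{\mathbb{R}}f(t)e^{\frac{\pi i}{b}(at^2+2pt-2\omega t+2(bq-dp)\omega+d\omega^2)}\,dt$. The operator $B$ acts by $(Bf)(t)=f'(t)+\frac{2\pi i a}{b}t f(t)$, and $B(\mathcal{F}_Af)(\omega)=(\mathcal{F}_Af)'(\omega)+\frac{2\pi i a}{b}\omega\,\mathcal{F}_Af(\omega)$. *)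

theory Defs
  imports "HOL-Analysis.Analysis"
begin

definition iter_deriv :: "nat \<Rightarrow> (real \<Rightarrow> complex) \<Rightarrow> real \<Rightarrow> complex" where
  "iter_deriv k f = ((\<lambda>g t. vector_derivative g (at t)) ^^ k) f"

text \<open>The Schwartz space of the real line. The differentiability clause is needed because
  \<^const>\<open>vector_derivative\<close> is an arbitrary value where no derivative exists.\<close>

definition schwartz_space :: "(real \<Rightarrow> complex) set" where
  "schwartz_space = {f.
     (\<forall>k t. iter_deriv k f differentiable (at t)) \<and>
     (\<forall>m k. bounded (range (\<lambda>t. complex_of_real (t ^ m) * iter_deriv k f t)))}"

text \<open>The special affine Fourier transform with parameters \<open>{a, b, c, d, p, q}\<close>. The parameter
  \<open>c\<close> does not occur in the kernel; it enters only through the constraint \<open>a d - b c = 1\<close>.\<close>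

definition saft ::
  "real \<Rightarrow> real \<Rightarrow> real \<Rightarrow> real \<Rightarrow> real \<Rightarrow> (real \<Rightarrow> complex) \<Rightarrow> real \<Rightarrow> complex" where
  "saft a b d p q f \<omega> =
     complex_of_real (1 / sqrt \<bar>b\<bar>) *
     (LINT t|lborel. f t *
        exp (complex_of_real pi * \<i> / complex_of_real b *
             complex_of_real (a * t\<^sup>2 + 2 * p * t - 2 * \<omega> * t
                              + 2 * (b * q - d * p) * \<omega> + d * \<omega>\<^sup>2)))"

definition opB :: "real \<Rightarrow> real \<Rightarrow> (real \<Rightarrow> complex) \<Rightarrow> real \<Rightarrow> complex" where
  "opB a b f t = vector_derivative f (at t) +
     2 * complex_of_real pi * \<i> * complex_of_real a / complex_of_real b * complex_of_real t * f t"

end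

theory Submission
  imports Defs "HOL-Probability.Sinc_Integral" "HOL-Probability.Characteristic_Functions"
begin

text \<open>Part (i) is integration by parts on the whole line: the product of a Schwartz function with the
  chirp kernel vanishes at both ends, so its derivative integrates to zero. For part (ii), the
  transform is a chirp in \<open>\<omega>\<close> times a Fourier integral, and the estimate
  \<open>|exp(i x) - 1 - i x| \<le> x\<^sup>2/2\<close> allows differentiation under the integral sign as soon as the
  second moment of the integrand is finite.\<close>

section \<open>Integrability and decay of Schwartz functions\<close>

text \<open>Adding the two bounds gives \<open>norm (g t) * (1 + t\<^sup>2) \<le> C + D\<close>, so
  a multiple of the integrable function \<open>inverse (1 + t\<^sup>2)\<close> dominates
  \<open>g\<close>. Continuity supplies measurability.\<close>

lemma integrable_quadratic_decay:
  fixes g :: "real \<Rightarrow> complex"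
  assumes cont: "continuous_on UNIV g"
    and bnd: "bounded (range g)"
    and bnd2: "bounded (range (\<lambda>t. complex_of_real (t\<^sup>2) * g t))"
  shows "integrable lborel g"
proof -
  obtain C where C: "\<And>t. norm (g t) \<le> C"
    using bnd by (auto simp: bounded_iff)
  obtain D where D: "\<And>t. norm (complex_of_real (t\<^sup>2) * g t) \<le> D"
    using bnd2 by (auto simp: bounded_iff)
  have "integrable lborel (\<lambda>t::real. inverse (1 + t\<^sup>2))"
    using integrable_inverse_1_plus_square
    by (simp add: set_integrable_def)
  then have "integrable lborel (\<lambda>t::real. (C + D) * inverse (1 + t\<^sup>2))"
    by simp
  then show ?thesis
  proof (rule Bochner_Integration.integrable_bound)
    show "g \<in> borel_measurable lborel"
      using borel_measurable_continuous_onI[OF cont] by simp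
    show "AE t in lborel. norm (g t) \<le> norm ((C + D) * inverse (1 + t\<^sup>2))"
    proof (rule AE_I2)
      fix t :: real
      have pos: "0 < 1 + t\<^sup>2"
        by (simp add: add_pos_nonneg)
      have "norm (g t) * (1 + t\<^sup>2) \<le> C + D"
        using C[of t] D[of t] by (simp add: norm_mult norm_power algebra_simps)
      then have "norm (g t) \<le> (C + D) * inverse (1 + t\<^sup>2)"
        using pos by (simp add: field_simps)
      then show "norm (g t) \<le> norm ((C + D) * inverse (1 + t\<^sup>2))"
        by simp
    qed
  qed
qed

lemma iter_deriv_Suc: "iter_deriv (Suc k) f t = vector_derivative (iter_deriv k f) (at t)"
  by (simp add: iter_deriv_def)

text \<open>The differentiability clause of \<open>schwartz_space\<close> turns the chosen value
  \<open>vector_derivative\<close> into a true derivative.\<close>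

lemma schwartz_has_vector_derivative:
  assumes "f \<in> schwartz_space"
  shows "(iter_deriv k f has_vector_derivative iter_deriv (Suc k) f t) (at t)"
  using assms by (simp add: iter_deriv_Suc schwartz_space_def vector_derivative_works[symmetric])

lemma schwartz_continuous:
  assumes "f \<in> schwartz_space"
  shows "continuous_on A (iter_deriv k f)"
  using schwartz_has_vector_derivative[OF assms]
  by (meson continuous_at_imp_continuous_on has_vector_derivative_continuous)

lemma schwartz_integrable:
  assumes "f \<in> schwartz_space"
  shows "integrable lborel (\<lambda>t. complex_of_real (t ^ m) * iter_deriv k f t)"
proof (rule integrable_quadratic_decay)
  have *: "bounded (range (\<lambda>t. complex_of_real (t ^ n) * iter_deriv k f t))" for n
    using assms by (simp add: schwartz_space_def)
  show "bounded (range (\<lambda>t. complex_of_real (t ^ m) * iter_deriv k f t))"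
    by (rule *)
  \<comment> \<open>The two extra powers of \<open>t\<close> are absorbed by the Schwartz bound with
    exponent \<open>2 + m\<close>.\<close>
  show "bounded (range (\<lambda>t. complex_of_real (t\<^sup>2) * (complex_of_real (t ^ m) * iter_deriv k f t)))"
    using *[of "2 + m"] by (simp only: power_add of_real_mult mult.assoc)
  show "continuous_on UNIV (\<lambda>t. complex_of_real (t ^ m) * iter_deriv k f t)"
    by (intro continuous_intros schwartz_continuous assms)
qed

text \<open>The Schwartz bound with one power of \<open>t\<close> gives decay like 1/|t|. The filter
  \<open>at_infinity\<close> covers both ends of the line at once.\<close>

lemma schwartz_tendsto_0:
  assumes "f \<in> schwartz_space"
  shows "(iter_deriv k f \<longlongrightarrow> 0) at_infinity"
proof -
  have "bounded (range (\<lambda>t. complex_of_real (t ^ 1) * iter_deriv k f t))"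
    using assms unfolding schwartz_space_def by blast
  then obtain C where C: "\<And>t. norm (complex_of_real t * iter_deriv k f t) \<le> C"
    by (auto simp: bounded_iff)
  have "((\<lambda>t::real. C * norm (inverse t)) \<longlongrightarrow> 0) at_infinity"
    by (intro tendsto_mult_right_zero tendsto_norm_zero tendsto_inverse_0)
  moreover have "\<forall>\<^sub>F t in at_infinity. norm (iter_deriv k f t) \<le> C * norm (inverse t)"
    unfolding eventually_at_infinity
  \<comment> \<open>Radius 1 keeps \<open>t\<close> away from 0, so the bound \<open>C\<close> may
    be divided by |t|.\<close>
  proof (intro exI[of _ 1] allI impI)
    fix t :: real
    assume "1 \<le> norm t"
    then show "norm (iter_deriv k f t) \<le> C * norm (inverse t)"
      using C[of t] by (simp add: norm_mult field_simps)
  qed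
  ultimately show ?thesis
    by (rule Lim_null_comparison[rotated])
qed

section \<open>Unimodular factors and integration over the whole line\<close>

text \<open>\<open>iexp\<close> of a real number has norm 1, so \<open>g\<close> itself is the
  dominating function; continuity of \<open>\<theta>\<close> gives measurability.\<close>

lemma integrable_mult_iexp:
  fixes g :: "real \<Rightarrow> complex" and \<theta> :: "real \<Rightarrow> real"
  assumes "integrable lborel g" and "continuous_on UNIV \<theta>"
  shows "integrable lborel (\<lambda>t. g t * iexp (\<theta> t))"
proof (rule Bochner_Integration.integrable_bound[OF assms(1)])
  have "(\<lambda>t. iexp (\<theta> t)) \<in> borel_measurable borel"
    by (intro borel_measurable_continuous_onI continuous_intros assms(2))
  then show "(\<lambda>t. g t * iexp (\<theta> t)) \<in> borel_measurable lborel"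
    using borel_measurable_integrable[OF assms(1)] by simp
qed (simp add: norm_mult)

text \<open>Fundamental theorem of calculus with both boundary values zero. Applied to a product, it
  is the integration by parts behind part (i).\<close>

lemma LBINT_derivative_eq_0:
  fixes h h' :: "real \<Rightarrow> complex"
  assumes deriv: "\<And>t. (h has_vector_derivative h' t) (at t)"
    and cont: "continuous_on UNIV h'"
    and int: "integrable lborel h'"
    and lim: "(h \<longlongrightarrow> 0) at_infinity"
  shows "(LINT t|lborel. h' t) = 0"
proof -
  have "(LBINT t=-\<infinity>..\<infinity>. h' t) = 0 - 0"
  proof (rule interval_integral_FTC_integrable)
    show "isCont h' t" for t
      using cont by (simp add: continuous_on_eq_continuous_at)
    show "set_integrable lborel (einterval (-\<infinity>) \<infinity>) h'"
      using int by (simp add: set_integrable_def)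
    \<comment> \<open>Limits at the infinite endpoints are limits along \<open>at_bot\<close> and
      \<open>at_top\<close>, and both filters are finer than \<open>at_infinity\<close>.\<close>
    show "((h \<circ> real_of_ereal) \<longlongrightarrow> 0) (at_right (-\<infinity>))"
      unfolding ereal_tendsto_simps using lim at_bot_le_at_infinity by (rule tendsto_mono[rotated])
    show "((h \<circ> real_of_ereal) \<longlongrightarrow> 0) (at_left \<infinity>)"
      unfolding ereal_tendsto_simps using lim at_top_le_at_infinity by (rule tendsto_mono[rotated])
  qed (use deriv in auto)
  then show ?thesis
    by (simp add: interval_lebesgue_integral_def set_lebesgue_integral_def)
qed

section \<open>Differentiation of a Fourier integral\<close>

text \<open>The first-order Taylor remainder of \<open>iexp\<close> is quadratic in the phase
  increment, so the linear approximation of \<open>F\<close> has an error of order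
  \<open>(y - \<omega>)\<^sup>2\<close>. Moment 0 makes \<open>F\<close> exist, moment 1 its
  candidate derivative, and moment 2 bounds the error.\<close>

lemma fourier_integral_has_vector_derivative:
  fixes g :: "real \<Rightarrow> complex" and s \<omega> :: real
  assumes g: "\<And>m. m \<le> 2 \<Longrightarrow> integrable lborel (\<lambda>t. complex_of_real (t ^ m) * g t)"
  defines "F \<equiv> \<lambda>\<omega>. LINT t|lborel. g t * iexp (s * t * \<omega>)"
  shows "(F has_vector_derivative
    (LINT t|lborel. \<i> * of_real (s * t) * (g t * iexp (s * t * \<omega>)))) (at \<omega>)"
proof -
  define G where "G = (LINT t|lborel. \<i> * of_real (s * t) * (g t * iexp (s * t * \<omega>)))"
  \<comment> \<open>The integrand is the Taylor bound \<open>\<bar>x\<bar>\<^sup>2 / 2\<close> at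
    \<open>x = s * t * (y - \<omega>)\<close>, times the norm of \<open>g t\<close> and stripped of
    the factor \<open>(y - \<omega>)\<^sup>2\<close>.\<close>
  define M where "M = (LINT t|lborel. s\<^sup>2 / 2 * norm (complex_of_real (t\<^sup>2) * g t))"
  have g0: "integrable lborel (\<lambda>t. g t * iexp (s * t * x))" for x
    using g[of 0] by (intro integrable_mult_iexp continuous_intros) simp
  have g1: "integrable lborel (\<lambda>t. \<i> * of_real (s * t) * (g t * iexp (s * t * x)))" for x
  proof -
    have "integrable lborel (\<lambda>t. (complex_of_real (t ^ 1) * g t) * iexp (s * t * x))"
      by (intro integrable_mult_iexp continuous_intros g) simp
    then have "integrable lborel
        (\<lambda>t. (\<i> * of_real s) * ((complex_of_real (t ^ 1) * g t) * iexp (s * t * x)))"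
      by (rule integrable_mult_right)
    then show ?thesis
      by (simp add: mult_ac)
  qed
  have bound: "norm (F y - F \<omega> - (y - \<omega>) *\<^sub>R G) \<le> M * (y - \<omega>)\<^sup>2" for y
  proof -
    let ?r = "\<lambda>t. g t * iexp (s * t * y) - g t * iexp (s * t * \<omega>)
                   - (y - \<omega>) *\<^sub>R (\<i> * of_real (s * t) * (g t * iexp (s * t * \<omega>)))"
    have diff: "F y - F \<omega> - (y - \<omega>) *\<^sub>R G = (LINT t|lborel. ?r t)"
      unfolding F_def G_def
      by (simp only: Bochner_Integration.integral_diff Bochner_Integration.integrable_diff
          integral_scaleR_right integrable_scaleR_right g0 g1)
    have "norm (F y - F \<omega> - (y - \<omega>) *\<^sub>R G)
        \<le> (LINT t|lborel. (s\<^sup>2 / 2 * norm (complex_of_real (t\<^sup>2) * g t)) * (y - \<omega>)\<^sup>2)"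
      unfolding diff
    proof (rule Bochner_Integration.integral_norm_bound_integral)
      show "integrable lborel ?r"
        by (intro Bochner_Integration.integrable_diff integrable_scaleR_right g0 g1)
      show "integrable lborel (\<lambda>t. (s\<^sup>2 / 2 * norm (complex_of_real (t\<^sup>2) * g t)) * (y - \<omega>)\<^sup>2)"
        by (intro integrable_mult_left integrable_mult_right integrable_norm g) simp
      fix t
      \<comment> \<open>The phase increment from \<open>\<omega>\<close> to \<open>y\<close>; it
        reduces the remainder at \<open>\<omega>\<close> to the Taylor remainder of
        \<open>iexp\<close> at 0.\<close>
      define x where "x = s * t * (y - \<omega>)"
      have E: "iexp (s * t * y) = iexp (s * t * \<omega>) * iexp x"
        unfolding exp_add[symmetric] distrib_left[symmetric] of_real_add[symmetric]
        by (rule arg_cong[where f = iexp]) (simp add: x_def algebra_simps)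
      \<comment> \<open>A polynomial identity, with \<open>k\<close> and \<open>e\<close> standing
        for the exponentials at \<open>\<omega>\<close> and at the increment.\<close>
      have "u * (k * e) - u * k - (y - \<omega>) *\<^sub>R (\<i> * of_real (s * t) * (u * k)) =
          u * k * (e - (1 + \<i> * x))" for u k e :: complex
        by (simp add: x_def scaleR_conv_of_real algebra_simps)
      then have "?r t = g t * iexp (s * t * \<omega>) * (iexp x - (1 + \<i> * x))"
        unfolding E .
      then have "norm (?r t) = norm (g t) * norm (iexp x - (1 + \<i> * x))"
        by (simp add: norm_mult)
      also have "\<dots> \<le> norm (g t) * (\<bar>x\<bar>\<^sup>2 / 2)"
        using iexp_approx1[of x 1] by (intro mult_left_mono) (simp_all add: numeral_2_eq_2)
      also have "\<dots> = (s\<^sup>2 / 2 * norm (complex_of_real (t\<^sup>2) * g t)) * (y - \<omega>)\<^sup>2"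
        by (simp add: x_def norm_mult norm_power power_mult_distrib)
      finally show "norm (?r t) \<le> (s\<^sup>2 / 2 * norm (complex_of_real (t\<^sup>2) * g t)) * (y - \<omega>)\<^sup>2" .
    qed
    also have "\<dots> = M * (y - \<omega>)\<^sup>2"
      unfolding M_def by (rule integral_mult_left_zero)
    finally show ?thesis .
  qed
  have "(F has_derivative (\<lambda>x. x *\<^sub>R G)) (at \<omega>)"
  \<comment> \<open>Dividing by |y - \<omega>| leaves a bound linear in |y - \<omega>|. It holds for
    every \<open>y \<noteq> \<omega>\<close>, so the radius 1 is an arbitrary choice.\<close>
  proof (rule has_derivativeI_sandwich[where e = 1 and H = "\<lambda>y. M * \<bar>y - \<omega>\<bar>"])
    show "bounded_linear (\<lambda>x. x *\<^sub>R G)"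
      by (rule bounded_linear_scaleR_left)
    show "norm (F y - F \<omega> - (y - \<omega>) *\<^sub>R G) / norm (y - \<omega>) \<le> M * \<bar>y - \<omega>\<bar>"
      if "y \<noteq> \<omega>" for y
      using bound[of y] that
      by (simp add: divide_le_eq mult.assoc power2_eq_square[symmetric])
    show "((\<lambda>y. M * \<bar>y - \<omega>\<bar>) \<longlongrightarrow> 0) (at \<omega>)"
      by (auto intro!: tendsto_eq_intros)
  qed simp
  then show ?thesis
    by (simp add: has_vector_derivative_def G_def)
qed

section \<open>The transform as a chirp times a Fourier integral\<close>

lemma saft_iexp:
  "saft a b d p q f \<omega> = complex_of_real (1 / sqrt \<bar>b\<bar>) *
     (LINT t|lborel. f t *
        iexp (pi / b * (a * t\<^sup>2 + 2 * p * t - 2 * \<omega> * t + 2 * (b * q - d * p) * \<omega> + d * \<omega>\<^sup>2)))"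
  unfolding saft_def by (simp add: mult_ac)

text \<open>The phase splits into a part in \<open>\<omega>\<close>, a part in \<open>t\<close> and
  the cross term. The first leaves the integral, the second joins \<open>f\<close>, and the third is
  a Fourier kernel with scale \<open>- (2 * pi / b)\<close>. In this form the transform can be
  differentiated in \<open>\<omega>\<close>.\<close>

lemma saft_eq_chirp_mult_fourier:
  "saft a b d p q f \<omega> = complex_of_real (1 / sqrt \<bar>b\<bar>) *
     iexp (pi / b * (2 * (b * q - d * p) * \<omega> + d * \<omega>\<^sup>2)) *
     (LINT t|lborel. (f t * iexp (pi / b * (a * t\<^sup>2 + 2 * p * t))) * iexp (- (2 * pi / b) * t * \<omega>))"
proof -
  have "iexp (pi / b * (a * t\<^sup>2 + 2 * p * t - 2 * \<omega> * t + 2 * (b * q - d * p) * \<omega> + d * \<omega>\<^sup>2)) =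
      iexp (pi / b * (2 * (b * q - d * p) * \<omega> + d * \<omega>\<^sup>2)) *
      (iexp (pi / b * (a * t\<^sup>2 + 2 * p * t)) * iexp (- (2 * pi / b) * t * \<omega>))" for t
    unfolding exp_add[symmetric] distrib_left[symmetric] of_real_add[symmetric]
    by (rule arg_cong[where f = iexp]) (simp add: divide_inverse algebra_simps)
  then have "saft a b d p q f \<omega> = complex_of_real (1 / sqrt \<bar>b\<bar>) *
     (LINT t|lborel. iexp (pi / b * (2 * (b * q - d * p) * \<omega> + d * \<omega>\<^sup>2)) *
        ((f t * iexp (pi / b * (a * t\<^sup>2 + 2 * p * t))) * iexp (- (2 * pi / b) * t * \<omega>)))"
    unfolding saft_iexp by (simp only: mult_ac)
  then show ?thesis
    by (simp only: integral_mult_right_zero mult.assoc)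
qed

section \<open>The operator B before and after the transform\<close>

text \<open>The part of the phase derivative that is linear in \<open>t\<close> is exactly the
  multiplication term of \<open>opB\<close>. Hence \<open>f\<close> times the kernel has derivative
  \<open>opB a b f\<close> minus \<open>c * f\<close>, times the kernel, with \<open>c\<close>
  constant in \<open>t\<close>; this derivative integrates to zero.\<close>

lemma saft_opB:
  assumes f: "f \<in> schwartz_space" and "b \<noteq> 0"
  shows "saft a b d p q (opB a b f) \<omega> =
    2 * complex_of_real pi * \<i> * complex_of_real ((\<omega> - p) / b) * saft a b d p q f \<omega>"
proof -
  define \<theta> where "\<theta> = (\<lambda>t.
    pi / b * (a * t\<^sup>2 + 2 * p * t - 2 * \<omega> * t + 2 * (b * q - d * p) * \<omega> + d * \<omega>\<^sup>2))"
  define \<theta>' where "\<theta>' t = 2 * pi / b * (a * t + p - \<omega>)" for t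
  define c where "c = 2 * complex_of_real pi * \<i> * complex_of_real ((\<omega> - p) / b)"
  have saft_eq: "saft a b d p q g \<omega> =
      complex_of_real (1 / sqrt \<bar>b\<bar>) * (LINT t|lborel. g t * iexp (\<theta> t))" for g
    unfolding saft_iexp \<theta>_def ..
  let ?h = "\<lambda>t. f t * iexp (\<theta> t)"
  let ?h' = "\<lambda>t. opB a b f t * iexp (\<theta> t) - c * (f t * iexp (\<theta> t))"
  have f0: "iter_deriv 0 f = f"
    by (simp add: iter_deriv_def)
  have f1: "iter_deriv 1 f t = vector_derivative f (at t)" for t
    by (simp add: iter_deriv_def)
  \<comment> \<open>Both summands now have the form of a power of \<open>t\<close> times an iterated
    derivative, up to a constant, as the Schwartz lemmas require.\<close>
  have opB_eq: "opB a b f = (\<lambda>t. iter_deriv 1 f t +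
      2 * complex_of_real pi * \<i> * complex_of_real a / complex_of_real b * (complex_of_real t * f t))"
    by (simp add: fun_eq_iff opB_def f1 mult.assoc del: One_nat_def)
  have cont_\<theta>: "continuous_on UNIV \<theta>"
    unfolding \<theta>_def by (intro continuous_intros)
  have cont_f: "continuous_on UNIV f"
    using schwartz_continuous[OF f, of _ 0] by (simp add: f0)
  have cont_B: "continuous_on UNIV (opB a b f)"
    unfolding opB_eq by (intro continuous_intros schwartz_continuous f cont_f)
  have int_f: "integrable lborel f"
    using schwartz_integrable[OF f, of 0 0] by (simp add: f0)
  have int_B: "integrable lborel (opB a b f)"
    using schwartz_integrable[OF f, of 0 1] schwartz_integrable[OF f, of 1 0]
    by (simp add: opB_eq f0)
  have deriv: "(?h has_vector_derivative ?h' t) (at t)" for t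
  proof -
    have "(\<theta> has_real_derivative \<theta>' t) (at t)"
      unfolding \<theta>_def \<theta>'_def
      using \<open>b \<noteq> 0\<close> by (auto intro!: derivative_eq_intros simp: field_simps)
    then have "((\<lambda>t. \<i> * of_real (\<theta> t)) has_vector_derivative \<i> * of_real (\<theta>' t)) (at t)"
      by (intro has_vector_derivative_mult_right has_vector_derivative_of_real)
    then have "((\<lambda>t. iexp (\<theta> t)) has_vector_derivative \<i> * of_real (\<theta>' t) * iexp (\<theta> t)) (at t)"
      using field_vector_diff_chain_at[OF _ DERIV_exp] by (auto simp: o_def)
    moreover have "(f has_vector_derivative iter_deriv 1 f t) (at t)"
      using schwartz_has_vector_derivative[OF f, of 0] by (simp add: f0)
    ultimately have "(?h has_vector_derivative
        f t * (\<i> * of_real (\<theta>' t) * iexp (\<theta> t)) + iter_deriv 1 f t * iexp (\<theta> t)) (at t)"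
      by (intro has_vector_derivative_mult)
    \<comment> \<open>The product rule is regrouped: \<open>\<i> * \<theta>' t\<close> equals the
      multiplication coefficient of \<open>opB\<close> at \<open>t\<close> minus
      \<open>c\<close>.\<close>
    moreover have "u * (\<i> * of_real (\<theta>' t) * k) + v * k =
        (v + 2 * complex_of_real pi * \<i> * complex_of_real a / complex_of_real b * (complex_of_real t * u)) * k
        - c * (u * k)" for u v k :: complex
      by (simp add: c_def \<theta>'_def divide_inverse algebra_simps)
    then have "f t * (\<i> * of_real (\<theta>' t) * iexp (\<theta> t)) + iter_deriv 1 f t * iexp (\<theta> t) = ?h' t"
      unfolding opB_eq .
    ultimately show ?thesis
      by simp
  qed
  have int_h: "integrable lborel ?h" and int_Bh: "integrable lborel (\<lambda>t. opB a b f t * iexp (\<theta> t))"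
    by (intro integrable_mult_iexp int_f int_B cont_\<theta>)+
  have "(LINT t|lborel. ?h' t) = 0"
  proof (rule LBINT_derivative_eq_0)
    show "(?h has_vector_derivative ?h' t) (at t)" for t
      by (rule deriv)
    show "continuous_on UNIV ?h'"
      by (intro continuous_intros cont_f cont_B cont_\<theta>)
    show "integrable lborel ?h'"
      by (intro Bochner_Integration.integrable_diff integrable_mult_right int_h int_Bh)
    \<comment> \<open>The kernel has modulus 1, so \<open>?h\<close> has the same norm as
      \<open>f\<close> and decays with it.\<close>
    have "((\<lambda>t. norm (f t)) \<longlongrightarrow> 0) at_infinity"
      using schwartz_tendsto_0[OF f, of 0] by (simp add: f0 tendsto_norm_zero)
    then show "(?h \<longlongrightarrow> 0) at_infinity"
      by (intro tendsto_norm_zero_cancel[of ?h]) (simp add: norm_mult)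
  qed
  then have "(LINT t|lborel. opB a b f t * iexp (\<theta> t)) = c * (LINT t|lborel. f t * iexp (\<theta> t))"
    using int_h int_Bh by simp
  then show ?thesis
    unfolding saft_eq c_def[symmetric] by simp
qed

text \<open>Product rule for the chirp and the Fourier integral. The chirp contributes the factor
  \<open>d * \<omega> + (b * q - d * p)\<close>; the Fourier integral brings down a factor
  \<open>t\<close>, hence the transform of \<open>t\<close> times \<open>f\<close>.\<close>

lemma saft_has_vector_derivative:
  assumes f: "f \<in> schwartz_space" and "b \<noteq> 0"
  shows "(saft a b d p q f has_vector_derivative
    2 * complex_of_real pi * \<i> / complex_of_real b *
      (complex_of_real (d * \<omega> + (b * q - d * p)) * saft a b d p q f \<omega>
        - saft a b d p q (\<lambda>t. complex_of_real t * f t) \<omega>)) (at \<omega>)"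
proof -
  define g where "g t = f t * iexp (pi / b * (a * t\<^sup>2 + 2 * p * t))" for t
  define s where "s = - (2 * pi / b)"
  define F where "F \<omega> = (LINT t|lborel. g t * iexp (s * t * \<omega>))" for \<omega>
  define F' where "F' = (LINT t|lborel. (complex_of_real t * g t) * iexp (s * t * \<omega>))"
  define \<eta> where "\<eta> = (\<lambda>\<omega>. pi / b * (2 * (b * q - d * p) * \<omega> + d * \<omega>\<^sup>2))"
  define \<eta>' where "\<eta>' = 2 * pi / b * (b * q - d * p + d * \<omega>)"
  define C where "C = complex_of_real (1 / sqrt \<bar>b\<bar>)"
  have saft_f: "saft a b d p q f = (\<lambda>\<omega>. C * iexp (\<eta> \<omega>) * F \<omega>)"
    unfolding saft_eq_chirp_mult_fourier fun_eq_iff C_def \<eta>_def F_def s_def g_def by simp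
  have saft_tf: "saft a b d p q (\<lambda>t. complex_of_real t * f t) \<omega> = C * iexp (\<eta> \<omega>) * F'"
    unfolding saft_eq_chirp_mult_fourier C_def \<eta>_def F'_def s_def g_def by (simp only: mult.assoc)
  have int_g: "integrable lborel (\<lambda>t. complex_of_real (t ^ m) * g t)" for m
  proof -
    have "integrable lborel (\<lambda>t. complex_of_real (t ^ m) * f t)"
      using schwartz_integrable[OF f, of m 0] by (simp add: iter_deriv_def)
    then have "integrable lborel
        (\<lambda>t. (complex_of_real (t ^ m) * f t) * iexp (pi / b * (a * t\<^sup>2 + 2 * p * t)))"
      by (intro integrable_mult_iexp continuous_intros)
    then show ?thesis
      by (simp only: g_def mult.assoc)
  qed
  have "(F has_vector_derivative
      (LINT t|lborel. \<i> * of_real (s * t) * (g t * iexp (s * t * \<omega>)))) (at \<omega>)"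
    unfolding F_def by (rule fourier_integral_has_vector_derivative) (rule int_g)
  also have "(LINT t|lborel. \<i> * of_real (s * t) * (g t * iexp (s * t * \<omega>))) =
      (LINT t|lborel. (\<i> * of_real s) * ((complex_of_real t * g t) * iexp (s * t * \<omega>)))"
    by (simp only: of_real_mult mult.assoc)
  also have "\<dots> = \<i> * of_real s * F'"
    unfolding F'_def by (rule integral_mult_right_zero)
  finally have dF: "(F has_vector_derivative \<i> * of_real s * F') (at \<omega>)" .
  have "(\<eta> has_real_derivative \<eta>') (at \<omega>)"
    unfolding \<eta>_def \<eta>'_def
    using \<open>b \<noteq> 0\<close> by (auto intro!: derivative_eq_intros simp: field_simps)
  then have "((\<lambda>\<omega>. \<i> * of_real (\<eta> \<omega>)) has_vector_derivative \<i> * of_real \<eta>') (at \<omega>)"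
    by (intro has_vector_derivative_mult_right has_vector_derivative_of_real)
  then have "((\<lambda>\<omega>. iexp (\<eta> \<omega>)) has_vector_derivative \<i> * of_real \<eta>' * iexp (\<eta> \<omega>)) (at \<omega>)"
    using field_vector_diff_chain_at[OF _ DERIV_exp] by (auto simp: o_def)
  then have "((\<lambda>\<omega>. C * iexp (\<eta> \<omega>) * F \<omega>) has_vector_derivative
      C * iexp (\<eta> \<omega>) * (\<i> * of_real s * F') + C * (\<i> * of_real \<eta>' * iexp (\<eta> \<omega>)) * F \<omega>) (at \<omega>)"
    by (intro has_vector_derivative_mult has_vector_derivative_mult_right dF)
  \<comment> \<open>Both inner derivatives contain 2 pi \<i> / b: it appears in
    \<open>\<i> * s\<close> with factor -1 and in \<open>\<i> * \<eta>'\<close> with factor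
    \<open>d * \<omega> + (b * q - d * p)\<close>.\<close>
  moreover have "C * k * (\<i> * of_real s * F') + C * (\<i> * of_real \<eta>' * k) * u =
      2 * complex_of_real pi * \<i> / complex_of_real b *
      (complex_of_real (d * \<omega> + (b * q - d * p)) * (C * k * u) - C * k * F')" for k u :: complex
    by (simp add: s_def \<eta>'_def divide_inverse algebra_simps)
  ultimately show ?thesis
    unfolding saft_tf unfolding saft_f by (simp only:)
qed

text \<open>The differentiability conjunct ensures that the \<open>vector_derivative\<close> inside
  \<open>opB a b (saft a b d p q f)\<close> is a genuine derivative, so the last equation has its
  intended meaning.\<close>

theorem proposition3p5:
  fixes a b c d p q \<Omega> :: real and f :: "real \<Rightarrow> complex"
  assumes det: "a * d - b * c = 1"
    and b_nonzero: "b \<noteq> 0"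
    and f_schwartz: "f \<in> schwartz_space"
    and Omega: "\<Omega> = b * q - d * p"
  shows "\<forall>\<omega>::real.
      saft a b d p q (opB a b f) \<omega> =
        2 * complex_of_real pi * \<i> * complex_of_real ((\<omega> - p) / b) * saft a b d p q f \<omega> \<and>
      saft a b d p q f differentiable (at \<omega>) \<and>
      opB a b (saft a b d p q f) \<omega> =
        2 * complex_of_real pi * \<i> / complex_of_real b *
          complex_of_real (a * \<omega> + d * \<omega> + \<Omega>) * saft a b d p q f \<omega>
        - 2 * complex_of_real pi * \<i> / complex_of_real b *
          saft a b d p q (\<lambda>t. complex_of_real t * f t) \<omega>"
proof (intro allI conjI)
  fix \<omega> :: real
  show "saft a b d p q (opB a b f) \<omega> =
      2 * complex_of_real pi * \<i> * complex_of_real ((\<omega> - p) / b) * saft a b d p q f \<omega>"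
    using f_schwartz b_nonzero by (rule saft_opB)
  note deriv = saft_has_vector_derivative[OF f_schwartz b_nonzero, of a d p q \<omega>]
  show "saft a b d p q f differentiable (at \<omega>)"
    using deriv by (rule differentiableI_vector)
  show "opB a b (saft a b d p q f) \<omega> =
      2 * complex_of_real pi * \<i> / complex_of_real b *
        complex_of_real (a * \<omega> + d * \<omega> + \<Omega>) * saft a b d p q f \<omega>
      - 2 * complex_of_real pi * \<i> / complex_of_real b *
        saft a b d p q (\<lambda>t. complex_of_real t * f t) \<omega>"
    \<comment> \<open>The multiplication term of \<open>opB\<close> adds \<open>a * \<omega>\<close>
      to the factor \<open>d * \<omega> + \<Omega>\<close> coming from the derivative.\<close>
    unfolding opB_def vector_derivative_at[OF deriv] Omega
    by (simp add: divide_inverse algebra_simps)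
qed

end
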